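(* Let $P_1,\dots,P_9\in\mathbb{P}^2$ (over $\mathbb{C}$) be points such that $P_1,\dots,P_6$ lie on a conic, $P_7=\overline{P_1P_2}\cap\overline{P_4P_5}$, $P_8=\overline{P_2P_3}\cap\overline{P_5P_6}$, $P_9=\overline{P_3P_4}\cap\overline{P_6P_1}$, and the only collinear triples among the nine points are the seven triples with index sets $\{1,2,7\},\{4,5,7\},\{2,3,8\},\{5,6,8\},\{3,4,9\},\{1,6,9\},\{7,8,9\}$. Let $x\in \mathrm{Gr}(3,9)$ be the row span of the $3\times 9$ matrix whose columns are homogeneous coordinates of $P_1,\dots,P_9$, let $\mathscr{M}_{\rm Pascal}=\mathscr{M}_x$, $I_{\rm Pascal}=I_x$ and $N_{\rm Pascal}=N_x$. Then the defining ideal $I_{\rm Pascal}$ of the matroid variety given by $\mathscr{M}_{\rm Pascal}$ contains at least one quartic, three independent cubics, and three independent quadrics that are not in the ideal $N_{\rm Pascal}$.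
   Context: For $x\in \mathrm{Gr}(r,n)$ (the Grassmannian of $r$-dimensional subspaces of $\mathbb{C}^n$), let $A_x$ be any $r\times n$ matrix whose rows form a basis of the subspace $x$. $\mathscr{M}_x$ is the matroid on $\Omega_n=\{1,\dots,n\}$ whose bases are the sets $\lambda$ of $r$ indices such that the columns of $A_x$ indexed by $\lambda$ are linearly independent. $\Gamma_x=\{y\in \mathrm{Gr}(r,n): \mathscr{M}_y=\mathscr{M}_x\}$ and the matroid variety is the Zariski closure $\mathcal{V}_x=\overline{\Gamma_x}\subset \mathrm{Gr}(r,n)$. For an $r$-element subset $\lambda=\{\lambda_1<\dots<\lambda_r\}$ of $\Omega_n$, the bracket $[\lambda]=[\lambda_1\cdots\lambda_r]$ is the Plücker coordinate given by the $r\times r$ minor on the columns $\lambda_1,\dots,\lambda_r$. $\mathbb{C}[\mathrm{Gr}(r,n)]$ is the homogeneous coordinate ring of the Grassmannian in its Plücker embedding, i.e. the polynomial ring in the brackets modulo the ideal of Plücker relations, graded so that each bracket has degree $1$. Quadrics, cubics and quartics are homogeneous elements of degree $2,3,4$ in the brackets. $I_x\subset\mathbb{C}[\mathrm{Gr}(r,n)]$ is the ideal of all elements vanishing on $\mathcal{V}_x$, and $N_x\subseteq I_x$ is the ideal generated by the brackets $[\lambda]$ with $\lambda$ an $r$-element subset of $\Omega_n$ that is not a basis of $\mathscr{M}_x$. A collection of elements of $\mathbb{C}[\mathrm{Gr}(r,n)]$ is called independent if none of them is a $\mathbb{C}[\mathrm{Gr}(r,n)]$-linear combination of the others (i.e.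 none lies in the ideal generated by the others). *)

theory Defs
  imports
    "HOL-Analysis.Analysis"
    "HOL-Algebra.QuotRing"
    "HOL-Library.Poly_Mapping"
    "HOL-Library.Numeral_Type"
begin

text \<open>
  Throughout, r is the cardinality of the row index type \<open>'r\<close>, n is the cardinality of the column
  index type \<open>'n\<close>, and an r by n matrix has type \<open>complex^'n^'r\<close>. Most constants depend on r only
  through an argument \<open>TYPE('r)\<close>. All spans, dimensions and independence notions are over the
  complex numbers (the \<open>vec\<close> interpretation, not the real structure of \<open>complex^'n\<close>).
\<close>


section \<open>The Grassmannian and the matroid of a point\<close>

definition Gr :: "'r::finite itself \<Rightarrow> (complex^'n) set set" where
  "Gr _ = {x. vec.subspace x \<and> vec.dim x = CARD('r)}"

text \<open>The rows of \<open>A\<close>, as an indexed family, form a basis of \<open>x\<close>.\<close>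

definition represents :: "complex^'n^'r \<Rightarrow> (complex^'n) set \<Rightarrow> bool" where
  "represents A x \<longleftrightarrow>
     inj (\<lambda>i. row i A) \<and> vec.independent (rows A) \<and> vec.span (rows A) = x"

text \<open>
  The bases of the matroid of \<open>x\<close>; the matroid, whose ground set is always \<open>UNIV :: 'n set\<close>, is
  identified with its set of bases. For \<open>x\<close> in the Grassmannian a representing matrix exists and
  the condition does not depend on which one is taken.
\<close>

definition matroid_bases :: "'r::finite itself \<Rightarrow> (complex^'n) set \<Rightarrow> 'n set set" where
  "matroid_bases _ x =
     {l. card l = CARD('r) \<and>
         (\<forall>A :: complex^'n^'r. represents A x \<longrightarrow>
            inj_on (\<lambda>j. column j A) l \<and> vec.independent ((\<lambda>j. column j A) ` l))}"

definition matroid_stratum ::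
    "'r::finite itself \<Rightarrow> (complex^'n) set \<Rightarrow> (complex^'n) set set" where
  "matroid_stratum R x = {y \<in> Gr R. matroid_bases R y = matroid_bases R x}"


section \<open>Polynomials in the brackets\<close>

text \<open>
  A monomial is a finitely supported exponent function on sets of columns. The polynomials of
  interest only involve the variables indexed by sets of cardinality r.
\<close>

type_synonym 'n bracket_poly = "('n set \<Rightarrow>\<^sub>0 nat) \<Rightarrow>\<^sub>0 complex"

definition bracket_poly_ring :: "'r::finite itself \<Rightarrow> ('n bracket_poly) ring" where
  "bracket_poly_ring _ =
     \<lparr>carrier = {p. \<forall>m \<in> Poly_Mapping.keys p. \<forall>l \<in> Poly_Mapping.keys m. card l = CARD('r)},
      mult = (*), one = 1, zero = 0, add = (+)\<rparr>"

definition bracket_var :: "'n set \<Rightarrow> 'n bracket_poly" where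
  "bracket_var l = Poly_Mapping.single (Poly_Mapping.single l 1) 1"

definition homogeneous_poly :: "nat \<Rightarrow> 'n bracket_poly \<Rightarrow> bool" where
  "homogeneous_poly d p \<longleftrightarrow>
     (\<forall>m \<in> Poly_Mapping.keys p. (\<Sum>l \<in> Poly_Mapping.keys m. Poly_Mapping.lookup m l) = d)"

definition eval_poly :: "('n set \<Rightarrow> complex) \<Rightarrow> 'n bracket_poly \<Rightarrow> complex" where
  "eval_poly b p =
     (\<Sum>m \<in> Poly_Mapping.keys p. Poly_Mapping.lookup p m *
        (\<Prod>l \<in> Poly_Mapping.keys m. b l ^ Poly_Mapping.lookup m l))"

text \<open>
  The minor on the columns of \<open>l\<close> taken in increasing order; \<open>card {k. k < j}\<close> is the position of
  the index \<open>j\<close> of \<open>'r\<close>.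
\<close>

definition bracket_value ::
    "complex^('n::{finite,linorder})^('r::{finite,linorder}) \<Rightarrow> 'n set \<Rightarrow> complex" where
  "bracket_value A l =
     det (\<chi> i j. A $ i $ (sorted_list_of_set l ! card {k. k < j}))"


section \<open>The homogeneous coordinate ring\<close>

text \<open>The bracket of an arbitrary sequence of columns, with the alternating sign convention.\<close>

definition bracket :: "('n::linorder) list \<Rightarrow> 'n bracket_poly" where
  "bracket xs =
     (if distinct xs
      then (- 1) ^ card {(i, j). i < j \<and> j < length xs \<and> xs ! j < xs ! i} * bracket_var (set xs)
      else 0)"

definition plucker_relation :: "('n::linorder) list \<Rightarrow> 'n list \<Rightarrow> 'n bracket_poly" where
  "plucker_relation xs ys =
     (\<Sum>k<length ys. (- 1) ^ k * bracket (xs @ [ys ! k]) * bracket (take k ys @ drop (Suc k) ys))"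

definition plucker_relations :: "'r::finite itself \<Rightarrow> ('n::linorder) bracket_poly set" where
  "plucker_relations _ =
     {plucker_relation xs ys | xs ys.
        length xs + 1 = CARD('r) \<and> length ys = CARD('r) + 1}"

definition plucker_ideal :: "'r::finite itself \<Rightarrow> ('n::linorder) bracket_poly set" where
  "plucker_ideal R = genideal (bracket_poly_ring R) (plucker_relations R)"

definition coord_ring :: "'r::finite itself \<Rightarrow> (('n::linorder) bracket_poly set) ring" where
  "coord_ring R = bracket_poly_ring R Quot plucker_ideal R"

definition bracket_class ::
    "'r::finite itself \<Rightarrow> ('n::linorder) set \<Rightarrow> 'n bracket_poly set" where
  "bracket_class R l = plucker_ideal R +>\<^bsub>bracket_poly_ring R\<^esub> bracket_var l"

definition homogeneous_elements ::
    "'r::finite itself \<Rightarrow> nat \<Rightarrow> ('n::linorder) bracket_poly set set" where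
  "homogeneous_elements R d = {f \<in> carrier (coord_ring R). \<exists>p \<in> f. homogeneous_poly d p}"

text \<open>
  The Plucker relations vanish on the minors of a matrix, so the value does not depend on the
  representative \<open>p\<close> of the class \<open>f\<close>. Using all representing matrices \<open>A\<close> means vanishing on the
  whole punctured line of the affine cone over \<open>y\<close>, which for a homogeneous \<open>f\<close> is the same as
  vanishing for one \<open>A\<close>.
\<close>

definition vanishes_at ::
    "'r::{finite,linorder} itself \<Rightarrow> 'n bracket_poly set \<Rightarrow>
     (complex^('n::{finite,linorder})) set \<Rightarrow> bool" where
  "vanishes_at _ f y \<longleftrightarrow>
     (\<forall>A :: complex^('n::{finite,linorder})^('r::{finite,linorder}). represents A y \<longrightarrow> (\<forall>p \<in> f. eval_poly (bracket_value A) p = 0))"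


section \<open>Matroid varieties and their ideals\<close>

definition zariski_closed ::
    "'r::{finite,linorder} itself \<Rightarrow> (complex^('n::{finite,linorder})) set set \<Rightarrow> bool" where
  "zariski_closed R Z \<longleftrightarrow>
     (\<exists>F \<subseteq> (\<Union>d. homogeneous_elements R d). Z = {y \<in> Gr R. \<forall>f \<in> F. vanishes_at R f y})"

definition matroid_variety ::
    "'r::{finite,linorder} itself \<Rightarrow> (complex^('n::{finite,linorder})) set \<Rightarrow>
     (complex^('n::{finite,linorder})) set set" where
  "matroid_variety R x = \<Inter> {Z. zariski_closed R Z \<and> matroid_stratum R x \<subseteq> Z}"

definition matroid_variety_ideal ::
    "'r::{finite,linorder} itself \<Rightarrow> (complex^('n::{finite,linorder})) set \<Rightarrow>
     'n bracket_poly set set" where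
  "matroid_variety_ideal R x =
     {f \<in> carrier (coord_ring R). \<forall>y \<in> matroid_variety R x. vanishes_at R f y}"

definition nonbasis_ideal ::
    "'r::finite itself \<Rightarrow> (complex^('n::{finite,linorder})) set \<Rightarrow> 'n bracket_poly set set" where
  "nonbasis_ideal R x =
     genideal (coord_ring R)
       {bracket_class R l | l. card l = CARD('r) \<and> l \<notin> matroid_bases R x}"

text \<open>No member of the family lies in the ideal generated by the others.\<close>

definition independent_family :: "('a, 'b) ring_scheme \<Rightarrow> 'a list \<Rightarrow> bool" where
  "independent_family S fs \<longleftrightarrow>
     (\<forall>i < length fs. fs ! i \<notin> genideal S {fs ! j | j. j < length fs \<and> j \<noteq> i})"


section \<open>Points, lines and conics in the projective plane\<close>

text \<open>
  Points of the projective plane are given by nonzero coordinate vectors; a line is a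
  two-dimensional subspace.
\<close>

definition on_common_line :: "(complex^3) set \<Rightarrow> bool" where
  "on_common_line S \<longleftrightarrow> (\<exists>L. vec.subspace L \<and> vec.dim L = 2 \<and> S \<subseteq> L)"

definition on_common_conic :: "(complex^3) set \<Rightarrow> bool" where
  "on_common_conic S \<longleftrightarrow>
     (\<exists>Q :: complex^3^3. Q \<noteq> 0 \<and> transpose Q = Q \<and>
        (\<forall>v \<in> S. (\<Sum>i\<in>UNIV. \<Sum>j\<in>UNIV. Q $ i $ j * v $ i * v $ j) = 0))"

text \<open>
  In the index type \<open>9\<close> the numeral \<open>9\<close> denotes \<open>0\<close>, so that \<open>1, \<dots>, 9\<close> are the nine distinct
  indices, ordered by \<open>9 < 1 < \<dots> < 8\<close>. This cyclic change of the usual order does not affect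
  the brackets: moving the column \<open>9\<close> from the first to the last place of a 3 by 3 minor is an
  even permutation.
\<close>

definition pascal_configuration :: "(9 \<Rightarrow> complex^3) \<Rightarrow> bool" where
  "pascal_configuration P \<longleftrightarrow>
     (\<forall>i. P i \<noteq> 0) \<and>
     on_common_conic {P 1, P 2, P 3, P 4, P 5, P 6} \<and>
     vec.span {P 7} = vec.span {P 1, P 2} \<inter> vec.span {P 4, P 5} \<and>
     vec.span {P 8} = vec.span {P 2, P 3} \<inter> vec.span {P 5, P 6} \<and>
     vec.span {P 9} = vec.span {P 3, P 4} \<inter> vec.span {P 6, P 1} \<and>
     {T. card T = 3 \<and> on_common_line (P ` T)} =
       {{1, 2, 7}, {4, 5, 7}, {2, 3, 8}, {5, 6, 8}, {3, 4, 9}, {1, 6, 9}, {7, 8, 9}}"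

definition column_matrix :: "('n \<Rightarrow> complex^'r) \<Rightarrow> complex^'n^'r" where
  "column_matrix P = (\<chi> i j. P j $ i)"

definition row_span :: "complex^'n^'r \<Rightarrow> (complex^'n) set" where
  "row_span A = vec.span (rows A)"


section \<open>Well-formedness\<close>

lemma cring_bracket_poly_ring:
  fixes R :: "'r::finite itself"
  shows "cring (bracket_poly_ring R :: ('n bracket_poly) ring)"
proof (rule cringI)
  let ?R = "bracket_poly_ring R :: ('n bracket_poly) ring"
  show "abelian_group ?R"
  proof (rule abelian_groupI)
    fix x y assume "x \<in> carrier ?R" "y \<in> carrier ?R"
    then show "x \<oplus>\<^bsub>?R\<^esub> y \<in> carrier ?R"
      using Poly_Mapping.keys_add[of x y] by (fastforce simp: bracket_poly_ring_def)
  next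
    fix x assume x: "x \<in> carrier ?R"
    show "\<exists>y \<in> carrier ?R. y \<oplus>\<^bsub>?R\<^esub> x = \<zero>\<^bsub>?R\<^esub>"
      using x by (intro bexI[of _ "- x"]) (auto simp: bracket_poly_ring_def)
  qed (auto simp: bracket_poly_ring_def algebra_simps)
  show "comm_monoid ?R"
  proof (rule comm_monoidI)
    fix x y assume xy: "x \<in> carrier ?R" "y \<in> carrier ?R"
    show "x \<otimes>\<^bsub>?R\<^esub> y \<in> carrier ?R"
      unfolding bracket_poly_ring_def
    proof (clarsimp)
      fix m l assume "m \<in> Poly_Mapping.keys (x * y)" "l \<in> Poly_Mapping.keys m"
      moreover obtain a b where "m = a + b" "a \<in> Poly_Mapping.keys x" "b \<in> Poly_Mapping.keys y"
        using calculation(1) keys_mult[of x y] by blast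
      moreover have "l \<in> Poly_Mapping.keys a \<union> Poly_Mapping.keys b"
        using calculation Poly_Mapping.keys_add[of a b] by blast
      ultimately show "card l = CARD('r)"
        using xy by (auto simp: bracket_poly_ring_def)
    qed
  qed (auto simp: bracket_poly_ring_def algebra_simps)
qed (auto simp: bracket_poly_ring_def algebra_simps)

lemma bracket_in_carrier:
  fixes R :: "'r::finite itself"
  assumes "length xs = CARD('r)"
  shows "bracket xs \<in> carrier (bracket_poly_ring R)"
proof -
  interpret cring "bracket_poly_ring R :: 'a bracket_poly ring" by (rule cring_bracket_poly_ring)
  have v: "bracket_var (set xs) \<in> carrier (bracket_poly_ring R)" if "distinct xs"
    using that assms by (auto simp: bracket_poly_ring_def bracket_var_def distinct_card)
  have "- p \<in> carrier (bracket_poly_ring R)"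
    if "p \<in> carrier (bracket_poly_ring R)" for p :: "'a bracket_poly"
    using that by (auto simp: bracket_poly_ring_def)
  then have "(- 1) ^ k * p \<in> carrier (bracket_poly_ring R)"
    if "p \<in> carrier (bracket_poly_ring R)" for k and p :: "'a bracket_poly"
    using that by (cases "even k") auto
  then show ?thesis
    using v zero_closed by (auto simp: bracket_def bracket_poly_ring_def)
qed

lemma plucker_relations_in_carrier:
  fixes R :: "'r::finite itself"
  shows "(plucker_relations R :: ('n::linorder) bracket_poly set) \<subseteq> carrier (bracket_poly_ring R)"
proof
  fix p :: "'n bracket_poly" assume "p \<in> plucker_relations R"
  then obtain xs ys where p: "p = plucker_relation xs ys"
    and len: "length xs + 1 = CARD('r)" "length ys = CARD('r) + 1"
    by (auto simp: plucker_relations_def)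
  interpret cring "bracket_poly_ring R :: 'n bracket_poly ring" by (rule cring_bracket_poly_ring)
  have mult: "a * b \<in> carrier (bracket_poly_ring R)"
    if "a \<in> carrier (bracket_poly_ring R)" "b \<in> carrier (bracket_poly_ring R)"
    for a b :: "'n bracket_poly"
    using m_closed[OF that] by (simp add: bracket_poly_ring_def)
  have add: "a + b \<in> carrier (bracket_poly_ring R)"
    if "a \<in> carrier (bracket_poly_ring R)" "b \<in> carrier (bracket_poly_ring R)"
    for a b :: "'n bracket_poly"
    using a_closed[OF that] by (simp add: bracket_poly_ring_def)
  have neg: "- a \<in> carrier (bracket_poly_ring R)"
    if "a \<in> carrier (bracket_poly_ring R)" for a :: "'n bracket_poly"
    using that by (auto simp: bracket_poly_ring_def)
  have term_in: "(- 1) ^ k * bracket (xs @ [ys ! k]) * bracket (take k ys @ drop (Suc k) ys)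
      \<in> carrier (bracket_poly_ring R)" if "k < length ys" for k
  proof -
    have "bracket (xs @ [ys ! k]) \<in> carrier (bracket_poly_ring R)"
      "bracket (take k ys @ drop (Suc k) ys) \<in> carrier (bracket_poly_ring R)"
      using len that by (auto intro!: bracket_in_carrier)
    then show ?thesis
      by (cases "even k") (auto intro!: mult neg)
  qed
  have "(\<Sum>k\<in>K. (- 1) ^ k * bracket (xs @ [ys ! k]) * bracket (take k ys @ drop (Suc k) ys))
      \<in> carrier (bracket_poly_ring R)" if "finite K" "K \<subseteq> {..<length ys}" for K
    using that
  proof (induction K rule: finite_induct)
    case empty
    then show ?case by (simp add: bracket_poly_ring_def)
  next
    case (insert k K)
    then show ?case
      by (subst sum.insert) (auto intro!: add term_in)
  qed
  then show "p \<in> carrier (bracket_poly_ring R)"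
    unfolding p plucker_relation_def by blast
qed

lemma ideal_plucker_ideal: "ideal (plucker_ideal R) (bracket_poly_ring R)"
  unfolding plucker_ideal_def
  using cring.axioms(1)[OF cring_bracket_poly_ring] plucker_relations_in_carrier
  by (rule ring.genideal_ideal)

lemma cring_coord_ring: "cring (coord_ring R)"
  unfolding coord_ring_def
  by (rule ideal.quotient_is_cring[OF ideal_plucker_ideal cring_bracket_poly_ring])

lemma independent_family_appendD1:
  assumes "independent_family S (fs @ gs)"
  shows "independent_family S fs"
  unfolding independent_family_def
proof (intro allI impI notI)
  fix i assume i: "i < length fs"
    and mem: "fs ! i \<in> genideal S {fs ! j | j. j < length fs \<and> j \<noteq> i}"
  have "{fs ! j | j. j < length fs \<and> j \<noteq> i} \<subseteq>
      {(fs @ gs) ! j | j. j < length (fs @ gs) \<and> j \<noteq> i}" (is "?A \<subseteq> ?B")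
    by (auto simp: nth_append)
  then have "genideal S ?A \<subseteq> genideal S ?B"
    unfolding genideal_def by blast
  then show False
    using mem assms i unfolding independent_family_def
    by (auto simp: nth_append dest!: spec[of _ i])
qed

lemma independent_family_appendD2:
  assumes "independent_family S (fs @ gs)"
  shows "independent_family S gs"
  unfolding independent_family_def
proof (intro allI impI notI)
  fix i assume i: "i < length gs"
    and mem: "gs ! i \<in> genideal S {gs ! j | j. j < length gs \<and> j \<noteq> i}"
  have "{gs ! j | j. j < length gs \<and> j \<noteq> i} \<subseteq>
      {(fs @ gs) ! j | j. j < length (fs @ gs) \<and> j \<noteq> length fs + i}" (is "?A \<subseteq> ?B")
    by (force simp: nth_append intro: exI[of _ "length fs + _"])
  then have "genideal S ?A \<subseteq> genideal S ?B"
    unfolding genideal_def by blast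
  then show False
    using mem assms i unfolding independent_family_def
    by (auto dest!: spec[of _ "length fs + i"])
qed

end

theory Submission
  imports Defs
begin

text \<open>
  Write [u v w] for the determinant of three vectors of \<open>\<complex>\<^sup>3\<close>. The intersection point of the lines ab
  and cd is \<open>[a c d] b - [b c d] a\<close>, with coefficients that are themselves brackets. Let m7, m8, m9
  be these expressions for the three pairs of opposite sides 12, 45 and 23, 56 and 34, 61 of the
  hexagon. For a point configuration with the given matroid, P7 is a nonzero vector on the lines 12
  and 45, so m7 is a multiple of P7 (\<open>line_meet_parallel\<close>), and likewise for m8 and m9. The points P7, P8,
  P9 being collinear, every determinant that takes one entry from each of \<open>{P7, m7}\<close>, \<open>{P8, m8}\<close>,
  \<open>{P9, m9}\<close> vanishes on the whole stratum. Apart from \<open>[P7 P8 P9]\<close> there are seven of them. Expanded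
  in brackets they have degree 1 plus the number of m's: three quadrics, three cubics and one
  quartic, and the quartic is the condition for P1, ..., P6 to lie on a conic. Vanishing on the
  stratum is enough, since the matroid variety is its closure
  (\<open>poly_class_mem_matroid_variety_ideal\<close>).

  Non-membership in an ideal is seen by evaluation. The minors of any 3 by 9 matrix satisfy the
  Plucker relations (\<open>eval_plucker_ideal\<close>), so every such matrix defines a ring homomorphism from the
  coordinate ring to the complex numbers, and an element on which it is nonzero lies outside every
  ideal whose generators it annihilates (\<open>eval_genideal\<close>). For each of the seven elements there is a
  degenerate configuration, with zero or coincident columns, at which the seven non-basis brackets
  and the other six elements vanish while the chosen one does not (\<open>separating_matrices\<close>). This
  matrix shows both that the element is outside the ideal generated by the non-bases and that it is
  not a combination of the other six.

  The passage between matroids and minors is linear algebra: a set of columns is a basis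
  if and only if its minor is nonzero, for any choice of representing matrix
  (\<open>mem_matroid_bases_iff\<close>).
\<close>

section \<open>Evaluation and degree of bracket polynomials\<close>

definition eval_monomial :: "('n set \<Rightarrow> complex) \<Rightarrow> ('n set \<Rightarrow>\<^sub>0 nat) \<Rightarrow> complex" where
  "eval_monomial b m = (\<Prod>l \<in> Poly_Mapping.keys m. b l ^ Poly_Mapping.lookup m l)"

lemma eval_monomial_superset:
  assumes "finite S" "Poly_Mapping.keys m \<subseteq> S"
  shows "eval_monomial b m = (\<Prod>l \<in> S. b l ^ Poly_Mapping.lookup m l)"
  unfolding eval_monomial_def
  using assms by (intro prod.mono_neutral_left) (auto simp: in_keys_iff)

lemma eval_monomial_add: "eval_monomial b (m + k) = eval_monomial b m * eval_monomial b k"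
proof -
  let ?S = "Poly_Mapping.keys m \<union> Poly_Mapping.keys k"
  have S: "finite ?S" "Poly_Mapping.keys (m + k) \<subseteq> ?S"
    using Poly_Mapping.keys_add[of m k] by auto
  show ?thesis
    using S by (simp add: eval_monomial_superset[of ?S] lookup_add power_add prod.distrib)
qed

text \<open>
  Summing over a common finite superset of the supports turns the sum defining \<open>eval_poly\<close> into one that is
  visibly additive in the polynomial.
\<close>

lemma eval_poly_superset:
  assumes "finite S" "Poly_Mapping.keys p \<subseteq> S"
  shows "eval_poly b p = (\<Sum>m \<in> S. Poly_Mapping.lookup p m * eval_monomial b m)"
  unfolding eval_poly_def eval_monomial_def
  using assms by (intro sum.mono_neutral_left) (auto simp: in_keys_iff)

lemma eval_poly_zero [simp]: "eval_poly b 0 = 0"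
  by (simp add: eval_poly_def)

lemma eval_poly_add [simp]: "eval_poly b (p + q) = eval_poly b p + eval_poly b q"
proof -
  let ?S = "Poly_Mapping.keys p \<union> Poly_Mapping.keys q"
  have S: "finite ?S" "Poly_Mapping.keys (p + q) \<subseteq> ?S"
    using Poly_Mapping.keys_add[of p q] by auto
  show ?thesis
    using S by (simp add: eval_poly_superset[of ?S] lookup_add distrib_right sum.distrib)
qed

lemma eval_poly_uminus [simp]: "eval_poly b (- p) = - eval_poly b p"
  using eval_poly_add[of b p "- p"] by (simp add: eq_neg_iff_add_eq_0 add.commute)

lemma eval_poly_diff [simp]: "eval_poly b (p - q) = eval_poly b p - eval_poly b q"
  using eval_poly_add[of b p "- q"] by simp

lemma eval_poly_single: "eval_poly b (Poly_Mapping.single m c) = c * eval_monomial b m"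
  by (simp add: eval_poly_superset[of "{m}"])

text \<open>
  Every polynomial is a finite sum of terms, so multiplicativity of the evaluation reduces to the
  product of two terms.
\<close>

lemma bracket_poly_induct [case_names zero add_single]:
  fixes p :: "'n bracket_poly"
  assumes "P 0" and "\<And>m c q. P q \<Longrightarrow> P (Poly_Mapping.single m c + q)"
  shows "P p"
proof (induction p rule: update_induct)
  case const
  then show ?case by (rule assms(1))
next
  case (update p a c)
  have "Poly_Mapping.update a c p = Poly_Mapping.single a c + p"
    using update by (intro poly_mapping_eqI) (auto simp: lookup_update lookup_add lookup_single when_def in_keys_iff)
  then show ?case using assms(2) update by simp
qed

lemma eval_poly_mult [simp]: "eval_poly b (p * q) = eval_poly b p * eval_poly b q"
proof (induction p rule: bracket_poly_induct)
  case (add_single m c p)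
  have "eval_poly b (Poly_Mapping.single m c * q) = c * eval_monomial b m * eval_poly b q"
    by (induction q rule: bracket_poly_induct)
      (simp_all add: distrib_left mult_single eval_poly_single eval_monomial_add)
  then show ?case using add_single by (simp add: distrib_right eval_poly_single)
qed simp

lemma eval_poly_one [simp]: "eval_poly b 1 = 1"
  by (simp flip: single_one add: eval_poly_single eval_monomial_def)

lemma eval_poly_power [simp]: "eval_poly b (p ^ k) = eval_poly b p ^ k"
  by (induction k) simp_all

lemma eval_bracket_var [simp]: "eval_poly b (bracket_var l) = b l"
  by (simp add: bracket_var_def eval_poly_single eval_monomial_def)

definition monomial_degree :: "('n set \<Rightarrow>\<^sub>0 nat) \<Rightarrow> nat" where
  "monomial_degree m = (\<Sum>l \<in> Poly_Mapping.keys m. Poly_Mapping.lookup m l)"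

lemma monomial_degree_add: "monomial_degree (m + k) = monomial_degree m + monomial_degree k"
proof -
  let ?S = "Poly_Mapping.keys m \<union> Poly_Mapping.keys k"
  have superset: "monomial_degree j = (\<Sum>l \<in> ?S. Poly_Mapping.lookup j l)"
    if "Poly_Mapping.keys j \<subseteq> ?S" for j
    unfolding monomial_degree_def
    using that by (intro sum.mono_neutral_left) (auto simp: in_keys_iff)
  have "Poly_Mapping.keys (m + k) \<subseteq> ?S"
    using Poly_Mapping.keys_add[of m k] by auto
  then show ?thesis
    by (simp add: superset lookup_add sum.distrib)
qed

lemma homogeneous_poly_mult:
  assumes "homogeneous_poly d p" "homogeneous_poly e q"
  shows "homogeneous_poly (d + e) (p * q)"
  unfolding homogeneous_poly_def
proof
  fix m assume "m \<in> Poly_Mapping.keys (p * q)"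
  then obtain a b where m: "m = a + b" "a \<in> Poly_Mapping.keys p" "b \<in> Poly_Mapping.keys q"
    using keys_mult[of p q] by blast
  then show "(\<Sum>l\<in>Poly_Mapping.keys m. Poly_Mapping.lookup m l) = d + e"
    using assms monomial_degree_add[of a b] by (simp add: homogeneous_poly_def monomial_degree_def)
qed

lemma homogeneous_poly_diff:
  assumes "homogeneous_poly d p" "homogeneous_poly d q"
  shows "homogeneous_poly d (p - q)"
  using assms keys_diff[of p q] by (auto simp: homogeneous_poly_def)

lemma homogeneous_bracket: "homogeneous_poly 1 (bracket xs)"
proof -
  have v: "homogeneous_poly 1 (bracket_var l)" for l :: "'a set"
    by (simp add: homogeneous_poly_def bracket_var_def)
  have "homogeneous_poly 0 ((- 1 :: 'a bracket_poly) ^ k)" for k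
    by (cases "even k") (simp_all add: homogeneous_poly_def)
  from homogeneous_poly_mult[OF this v] show ?thesis
    by (auto simp: bracket_def) (simp add: homogeneous_poly_def)
qed

section \<open>Brackets of three columns and the Plucker relations\<close>

text \<open>
  The determinant of the matrix with columns \<open>u\<close>, \<open>v\<close>, \<open>w\<close>, expanded along the first column.
\<close>

definition triple_product :: "complex^3 \<Rightarrow> complex^3 \<Rightarrow> complex^3 \<Rightarrow> complex" where
  "triple_product u v w =
     u $ 1 * (v $ 2 * w $ 3 - v $ 3 * w $ 2) + u $ 2 * (v $ 3 * w $ 1 - v $ 1 * w $ 3)
       + u $ 3 * (v $ 1 * w $ 2 - v $ 2 * w $ 1)"

lemma triple_product_swap12: "triple_product v u w = - triple_product u v w"
  and triple_product_swap23: "triple_product u w v = - triple_product u v w"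
  by (simp_all add: triple_product_def algebra_simps)

lemma triple_product_eq [simp]: "triple_product u u w = 0" "triple_product u v u = 0" "triple_product u v v = 0"
  by (simp_all add: triple_product_def algebra_simps)

text \<open>
  In the index type \<open>3\<close> the numeral \<open>3\<close> denotes \<open>0\<close>, so the order is \<open>3 < 1 < 2\<close> and the three
  indices have the positions below in it.
\<close>

lemma card_below_three: "card {k::3. k < 3} = 0" "card {k::3. k < 1} = 1" "card {k::3. k < 2} = 2"
proof -
  have less: "(1::3) < 2" "(3::3) < 1" "(3::3) < 2" "\<not> (2::3) < 1" "\<not> (1::3) < 3" "\<not> (2::3) < 3"
    by (simp_all add: less_bit1_def bit1.Rep_numeral bit1.Rep_1)
  have "k < 3 \<longleftrightarrow> False" "k < 1 \<longleftrightarrow> k = 3" "k < 2 \<longleftrightarrow> k = 3 \<or> k = 1" for k :: 3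
    using exhaust_3[of k] less by (elim disjE; simp)+
  then have "{k::3. k < 3} = {}" "{k::3. k < 1} = {3}" "{k::3. k < 2} = {3, 1}"
    by blast+
  then show "card {k::3. k < 3} = 0" "card {k::3. k < 1} = 1" "card {k::3. k < 2} = 2"
    by simp_all
qed

lemma bracket_value_increasing:
  fixes A :: "complex^('n::{finite,linorder})^3"
  assumes "a < b" "b < c"
  shows "bracket_value A {a, b, c} = triple_product (column a A) (column b A) (column c A)"
proof -
  have "sorted_list_of_set (set [a, b, c]) = [a, b, c]"
    using assms by (intro sorted_list_of_set.idem_if_sorted_distinct) auto
  \<comment> \<open>The columns of the minor are a, b, c in the places 3, 1, 2: a cyclic, hence even, permutation.\<close>
  then show ?thesis
    by (simp add: bracket_value_def det_3 card_below_three triple_product_def column_def algebra_simps)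
qed

lemma card_inversions_three:
  fixes a b c :: "'n::linorder"
  shows "card {(i, j). i < j \<and> j < length [a, b, c] \<and> [a, b, c] ! j < [a, b, c] ! i} =
     of_bool (b < a) + of_bool (c < a) + of_bool (c < b)" (is "card ?I = _")
proof -
  have pairs: "i < j \<and> j < length [a, b, c] \<longleftrightarrow> i = 0 \<and> j = 1 \<or> i = 0 \<and> j = 2 \<or> i = 1 \<and> j = 2"
    for i j :: nat
    by auto
  have mem: "(i, j) \<in> ?I \<longleftrightarrow> i = 0 \<and> j = 1 \<and> b < a \<or> i = 0 \<and> j = 2 \<and> c < a \<or> i = 1 \<and> j = 2 \<and> c < b"
    for i j
  proof (cases "i < j \<and> j < length [a, b, c]")
    case True
    then consider "i = 0" "j = 1" | "i = 0" "j = 2" | "i = 1" "j = 2"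
      unfolding pairs by blast
    then show ?thesis by cases simp_all
  next
    case False
    with pairs[of i j] show ?thesis by blast
  qed
  let ?U = "(if b < a then {(0, 1)} else {}) \<union> (if c < a then {(0, 2)} else {})
      \<union> (if c < b then {(1, 2)} else {})"
  have "(i, j) \<in> ?I \<longleftrightarrow> (i, j) \<in> ?U" for i j
    unfolding mem by simp
  then have "?I = ?U"
    by (simp only: set_eq_iff split_paired_All) blast
  also have "card \<dots> = of_bool (b < a) + of_bool (c < a) + of_bool (c < b)"
    by (cases "b < a"; cases "c < a"; cases "c < b"; simp)
  finally show ?thesis .
qed

text \<open>
  The sign in \<open>bracket\<close> counts the inversions of the sequence, which is the sign by which the
  determinant changes when its columns are sorted; so the bracket of any sequence evaluates to the
  determinant in the given order.
\<close>

lemma eval_bracket_three: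
  fixes A :: "complex^('n::{finite,linorder})^3"
  shows "eval_poly (bracket_value A) (bracket [a, b, c]) =
    triple_product (column a A) (column b A) (column c A)"
proof (cases "distinct [a, b, c]")
  case False
  then show ?thesis by (auto simp: bracket_def)
next
  case True
  note swap = triple_product_swap12 triple_product_swap23
  have ev: "eval_poly (bracket_value A) (bracket [a, b, c]) =
    (- 1) ^ (of_bool (b < a) + of_bool (c < a) + of_bool (c < b)) * bracket_value A {a, b, c}"
    unfolding bracket_def card_inversions_three using True by simp
  consider "a < b" "b < c" "a < c" | "a < c" "c < b" "a < b" | "b < a" "a < c" "b < c"
    | "b < c" "c < a" "b < a" | "c < a" "a < b" "c < b" | "c < b" "b < a" "c < a"
    using True
    by (cases a b rule: linorder_cases; cases b c rule: linorder_cases; cases a c rule: linorder_cases)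
      auto
  then show ?thesis
  proof cases
    case 1
    then show ?thesis unfolding ev by (simp add: 1[THEN less_not_sym]  bracket_value_increasing)
  next
    case 2
    then show ?thesis unfolding ev
      using bracket_value_increasing[of a c b A] triple_product_swap23[of "column a A" "column b A" "column c A"]
      by (simp add: 2[THEN less_not_sym]  insert_commute)
  next
    case 3
    then show ?thesis unfolding ev
      using bracket_value_increasing[of b a c A] swap(1)[of "column b A" "column a A" "column c A"]
      by (simp add: 3[THEN less_not_sym]  insert_commute)
  next
    case 4
    then show ?thesis unfolding ev
      using bracket_value_increasing[of b c a A] 
      by (simp add: 4[THEN less_not_sym]  insert_commute triple_product_def algebra_simps)
  next
    case 5
    then show ?thesis unfolding ev
      using bracket_value_increasing[of c a b A] 
      by (simp add: 5[THEN less_not_sym]  insert_commute triple_product_def algebra_simps)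
  next
    case 6
    then show ?thesis unfolding ev
      using bracket_value_increasing[of c b a A] 
      by (simp add: 6[THEN less_not_sym]  insert_commute triple_product_def algebra_simps)
  qed
qed

lemma bracket_value_eq_0_iff:
  fixes A :: "complex^('n::{finite,linorder})^3"
  assumes "distinct [a, b, c]"
  shows "bracket_value A {a, b, c} = 0 \<longleftrightarrow> triple_product (column a A) (column b A) (column c A) = 0"
proof -
  have "eval_poly (bracket_value A) (bracket [a, b, c]) = (- 1) ^ k * bracket_value A {a, b, c}"
    if "k = card {(i, j). i < j \<and> j < length [a, b, c] \<and> [a, b, c] ! j < [a, b, c] ! i}" for k
    using assms that by (simp add: bracket_def)
  then show ?thesis by (simp add: eval_bracket_three)
qed

text \<open>
  Cramer's rule: four vectors of a three-dimensional space satisfy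
  \<open>[d e f] c - [c e f] d + [c d f] e - [c d e] f = 0\<close>. Apply the linear form \<open>[a b _]\<close> to it.
\<close>

lemma triple_product_exchange:
  "triple_product a b c * triple_product d e f - triple_product a b d * triple_product c e f
     + triple_product a b e * triple_product c d f - triple_product a b f * triple_product c d e = 0"
  by (simp add: triple_product_def algebra_simps)

lemma eval_plucker_relation:
  fixes A :: "complex^('n::{finite,linorder})^3"
  assumes "p \<in> plucker_relations TYPE(3)"
  shows "eval_poly (bracket_value A) p = 0"
proof -
  from assms obtain xs ys where p: "p = plucker_relation xs ys"
    and "length xs = 2" "length ys = 4"
    by (auto simp: plucker_relations_def)
  then obtain a b c d e f where "xs = [a, b]" "ys = [c, d, e, f]"
    by (auto simp: numeral_eq_Suc length_Suc_conv)
  then have "p = bracket [a, b, c] * bracket [d, e, f] - bracket [a, b, d] * bracket [c, e, f]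
      + bracket [a, b, e] * bracket [c, d, f] - bracket [a, b, f] * bracket [c, d, e]"
    by (simp add: p plucker_relation_def)
  then show ?thesis
    by (simp only: eval_poly_add eval_poly_diff eval_poly_mult eval_bracket_three triple_product_exchange)
qed

section \<open>Bases of the matroid as nonvanishing minors\<close>

text \<open>
  Representing matrices and matroid bases are defined by injective families with independent range,
  while invertibility of a matrix is a condition on the linear relations of an indexed family.
\<close>

lemma inj_independent_range_iff:
  fixes f :: "'i::finite \<Rightarrow> complex^'n"
  shows "inj f \<and> vec.independent (range f) \<longleftrightarrow> (\<forall>c. (\<Sum>i\<in>UNIV. c i *s f i) = 0 \<longrightarrow> (\<forall>i. c i = 0))"
    (is "?L \<longleftrightarrow> ?R")
proof
  assume L: ?L
  show ?R
  proof (intro allI impI)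
    fix c i assume "(\<Sum>i\<in>UNIV. c i *s f i) = 0"
    then have "(\<Sum>v\<in>range f. c (the_inv f v) *s v) = 0"
      using L by (simp add: sum.reindex the_inv_f_f)
    then have "c (the_inv f (f i)) = 0"
      using L vec.independentD[of "range f" "range f" "\<lambda>v. c (the_inv f v)" "f i"] by auto
    then show "c i = 0" using L by (simp add: the_inv_f_f)
  qed
next
  assume R: ?R
  have inj: "inj f"
  proof (rule injI, rule ccontr)
    fix i j assume eq: "f i = f j" "i \<noteq> j"
    have "(\<Sum>k\<in>UNIV. (of_bool (k = i) - of_bool (k = j)) *s f k) = f i - f j"
      by (simp add: vec.scale_left_diff_distrib sum_subtractf of_bool_def
          if_distrib[where f = "\<lambda>c. c *s _"] cong: if_cong)
    then have "of_bool (i = i) - of_bool (i = j) = (0::complex)"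
      using R[rule_format, of "\<lambda>k. of_bool (k = i) - of_bool (k = j)" i] eq(1) by simp
    with eq show False by simp
  qed
  have "vec.independent (range f)"
  proof (rule vec.independent_if_scalars_zero)
    fix g v assume "(\<Sum>v\<in>range f. g v *s v) = 0" "v \<in> range f"
    then show "g v = 0"
      using R[rule_format, of "g \<circ> f"] by (auto simp: sum.reindex[OF inj])
  qed simp
  with inj show ?L by blast
qed

lemma det_nz_iff_independent_columns:
  fixes M :: "complex^'n^'n"
  shows "det M \<noteq> 0 \<longleftrightarrow> inj (\<lambda>j. column j M) \<and> vec.independent (range (\<lambda>j. column j M))"
  unfolding inj_independent_range_iff invertible_det_nz[symmetric] invertible_left_inverse
    matrix_left_invertible_independent_columns ..

lemma card_below_bij:
  "bij_betw (\<lambda>j::'r::{finite,linorder}. card {k. k < j}) UNIV {..<CARD('r)}"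
proof -
  have less: "card {k. k < i} < card {k. k < j}" if "i < j" for i j :: 'r
    using that by (intro psubset_card_mono) (auto intro: less_trans)
  have inj: "inj (\<lambda>j::'r. card {k. k < j})"
    by (rule injI) (metis less less_irrefl linorder_less_linear)
  have "card {k. k < j} < CARD('r)" for j :: 'r
    by (intro psubset_card_mono) auto
  then have "range (\<lambda>j::'r. card {k. k < j}) \<subseteq> {..<CARD('r)}" by auto
  moreover have "card (range (\<lambda>j::'r. card {k. k < j})) = CARD('r)"
    using inj by (rule card_image)
  ultimately show ?thesis
    using inj by (simp add: bij_betw_def card_subset_eq)
qed

lemma sorted_enumeration_bij:
  fixes l :: "'n::{finite,linorder} set"
  assumes "card l = CARD('r::{finite,linorder})"
  shows "bij_betw (\<lambda>j::'r. sorted_list_of_set l ! card {k. k < j}) UNIV l"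
proof -
  have "bij_betw ((!) (sorted_list_of_set l)) {..<CARD('r)} l"
    using assms by (intro bij_betw_nth) auto
  from bij_betw_trans[OF card_below_bij this] show ?thesis
    by (simp add: comp_def)
qed

lemma bracket_value_nonzero_iff:
  fixes A :: "complex^('n::{finite,linorder})^('r::{finite,linorder})"
  assumes "card l = CARD('r)"
  shows "bracket_value A l \<noteq> 0 \<longleftrightarrow> inj_on (\<lambda>j. column j A) l \<and> vec.independent ((\<lambda>j. column j A) ` l)"
proof -
  define e where "e = (\<lambda>j::'r. sorted_list_of_set l ! card {k. k < j})"
  have e: "inj e" "range e = l"
    using sorted_enumeration_bij[OF assms] by (auto simp: e_def bij_betw_def)
  let ?M = "\<chi> i j. A $ i $ e j"
  have col: "column j ?M = column (e j) A" for j
    by (simp add: column_def)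
  have "bracket_value A l = det ?M"
    by (simp add: bracket_value_def e_def)
  moreover have "inj (\<lambda>j. column (e j) A) \<longleftrightarrow> inj_on (\<lambda>j. column j A) l"
    using e inj_on_imageI[of "\<lambda>j. column j A" e UNIV] comp_inj_on[of e UNIV "\<lambda>j. column j A"]
    by (auto simp: comp_def)
  moreover have "range (\<lambda>j. column (e j) A) = (\<lambda>j. column j A) ` l"
    using e by auto
  ultimately show ?thesis
    by (simp add: det_nz_iff_independent_columns col)
qed

lemma bracket_value_matrix_mult:
  fixes A :: "complex^('n::{finite,linorder})^('r::{finite,linorder})"
    and G :: "complex^('r::{finite,linorder})^('r::{finite,linorder})"
  shows "bracket_value (G ** A) l = det G * bracket_value A l"
proof -
  let ?e = "\<lambda>j::'r. sorted_list_of_set l ! card {k. k < j}"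
  have "(\<chi> i j. (G ** A) $ i $ ?e j) = G ** (\<chi> i j. A $ i $ ?e j)"
    by (simp add: matrix_matrix_mult_def vec_eq_iff)
  then show ?thesis by (simp add: bracket_value_def det_mul)
qed

text \<open>
  Two bases of the same subspace differ by a change of basis.
\<close>

lemma represents_same_imp_mult:
  fixes A B :: "complex^'n^'r"
  assumes "represents A x" "represents B x"
  shows "\<exists>G. B = G ** A"
proof -
  have "\<exists>c. row i B = (\<Sum>k\<in>UNIV. c k *s row k A)" for i
  proof -
    have "row i B \<in> vec.span (range (\<lambda>k. row k A))"
      using assms vec.span_base[of "row i B" "rows B"]
      by (auto simp: represents_def rows_def full_SetCompr_eq)
    then obtain g where g: "row i B = (\<Sum>v\<in>range (\<lambda>k. row k A). g v *s v)"
      by (auto simp: vec.span_finite)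
    have "inj (\<lambda>k. row k A)" using assms by (simp add: represents_def)
    with g show ?thesis by (auto simp: sum.reindex)
  qed
  then obtain c where c: "\<And>i. row i B = (\<Sum>k\<in>UNIV. c i k *s row k A)"
    by metis
  have "B = (\<chi> i k. c i k) ** A"
    unfolding vec_eq_iff matrix_matrix_mult_def
  proof (intro allI)
    fix i j
    have "B $ i $ j = row i B $ j" by (simp add: row_def)
    also have "\<dots> = (\<Sum>k\<in>UNIV. c i k * A $ k $ j)"
      unfolding c by (simp add: row_def)
    finally show "B $ i $ j = (\<chi> i j. \<Sum>k\<in>UNIV. (\<chi> i k. c i k) $ i $ k * A $ k $ j) $ i $ j" by simp
  qed
  then show ?thesis ..
qed

text \<open>
  All minors of two matrices representing the same subspace differ by the common factor \<open>det G\<close> of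
  \<open>represents_same_imp_mult\<close>, so the quantifier over all representing matrices in \<open>matroid_bases\<close> can
  be replaced by any one of them.
\<close>

lemma mem_matroid_bases_iff:
  fixes A :: "complex^('n::{finite,linorder})^('r::{finite,linorder})"
  assumes "represents A x"
  shows "l \<in> matroid_bases TYPE('r) x \<longleftrightarrow> card l = CARD('r) \<and> bracket_value A l \<noteq> 0"
proof -
  have transfer: "bracket_value B l \<noteq> 0" if B: "represents B x" and nz: "bracket_value A l \<noteq> 0"
    for B :: "complex^('n::{finite,linorder})^('r::{finite,linorder})"
  proof -
    obtain G where "A = G ** B"
      using represents_same_imp_mult[OF B assms] by blast
    with nz show ?thesis by (simp add: bracket_value_matrix_mult)
  qed
  show ?thesis
  proof
    assume "l \<in> matroid_bases TYPE('r) x"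
    with assms show "card l = CARD('r) \<and> bracket_value A l \<noteq> 0"
      by (simp add: matroid_bases_def bracket_value_nonzero_iff)
  next
    assume "card l = CARD('r) \<and> bracket_value A l \<noteq> 0"
    then show "l \<in> matroid_bases TYPE('r) x"
      using transfer by (simp add: matroid_bases_def flip: bracket_value_nonzero_iff)
  qed
qed

text \<open>
  A linear relation between the rows of \<open>A\<close> restricts to a relation between the rows of each of its
  maximal square submatrices, and the rows of an invertible one satisfy only the trivial relation.
\<close>

lemma represents_row_span:
  fixes A :: "complex^('n::{finite,linorder})^('r::{finite,linorder})"
  assumes "bracket_value A l \<noteq> 0"
  shows "represents A (row_span A)"
proof -
  let ?e = "\<lambda>j::'r. sorted_list_of_set l ! card {k. k < j}"
  let ?M = "\<chi> i j. A $ i $ ?e j"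
  have "invertible ?M"
    using assms by (simp add: bracket_value_def invertible_det_nz)
  then have M: "\<forall>c. (\<Sum>i\<in>UNIV. c i *s row i ?M) = 0 \<longrightarrow> (\<forall>i. c i = 0)"
    unfolding invertible_right_inverse matrix_right_invertible_independent_rows .
  have "\<forall>c. (\<Sum>i\<in>UNIV. c i *s row i A) = 0 \<longrightarrow> (\<forall>i. c i = 0)"
  proof (intro allI impI)
    fix c i assume "(\<Sum>i\<in>UNIV. c i *s row i A) = 0"
    then have "(\<Sum>i\<in>UNIV. c i *s row i ?M) = 0"
      by (simp add: vec_eq_iff row_def)
    with M show "c i = 0" by blast
  qed
  then have "inj (\<lambda>i. row i A) \<and> vec.independent (range (\<lambda>i. row i A))"
    unfolding inj_independent_range_iff .
  then show ?thesis
    by (simp add: represents_def row_span_def rows_def full_SetCompr_eq)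
qed

text \<open>
  A set of rank less than 2 also lies in some two-dimensional subspace, because a basis of its span
  extends to a basis of the whole space.
\<close>

lemma on_common_line_iff:
  fixes S :: "(complex^3) set"
  shows "on_common_line S \<longleftrightarrow> vec.dim S \<le> 2"
proof
  assume "on_common_line S"
  then show "vec.dim S \<le> 2"
    unfolding on_common_line_def using vec.dim_subset by (metis)
next
  assume dim: "vec.dim S \<le> 2"
  obtain B where B: "B \<subseteq> S" "vec.independent B" "S \<subseteq> vec.span B" "card B = vec.dim S"
    using vec.basis_exists by blast
  define C where "C = vec.extend_basis B"
  have C: "B \<subseteq> C" "vec.independent C" "vec.span C = UNIV"
    using B by (auto simp: C_def vec.extend_basis_superset vec.independent_extend_basis vec.span_extend_basis)
  have "card C = 3"
    using vec.dim_eq_card[of C UNIV] C by (simp add: vec.dim_UNIV card_cart_basis)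
  moreover have "finite C" using calculation by (simp add: card_ge_0_finite)
  ultimately obtain D where D: "B \<subseteq> D" "D \<subseteq> C" "card D = 2"
    using exists_subset_between[of B 2 C] B C dim by auto
  have "vec.independent D" using C D vec.independent_mono by blast
  then have "vec.dim (vec.span D) = 2"
    using D by (simp add: vec.dim_eq_card_independent)
  moreover have "S \<subseteq> vec.span D" using B D vec.span_mono by blast
  ultimately show "on_common_line S"
    unfolding on_common_line_def by (blast intro: vec.subspace_span)
qed

lemma column_column_matrix [simp]: "column j (column_matrix P) = P j"
  by (simp add: column_def column_matrix_def vec_eq_iff)

lemma bracket_value_column_matrix_eq_0_iff:
  fixes P :: "'n::{finite,linorder} \<Rightarrow> complex^3"
  assumes "card T = 3"
  shows "bracket_value (column_matrix P) T = 0 \<longleftrightarrow> on_common_line (P ` T)"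
proof -
  have fin: "finite T" using assms by (simp add: card_ge_0_finite)
  have "inj_on P T \<and> vec.independent (P ` T) \<longleftrightarrow> \<not> vec.dim (P ` T) \<le> 2"
  proof
    assume *: "inj_on P T \<and> vec.independent (P ` T)"
    then have "vec.dim (P ` T) = 3"
      using assms by (simp add: vec.dim_eq_card_independent card_image)
    then show "\<not> vec.dim (P ` T) \<le> 2" by simp
  next
    assume *: "\<not> vec.dim (P ` T) \<le> 2"
    have "vec.dim (P ` T) \<le> card (P ` T)" using fin by (simp add: vec.dim_le_card')
    moreover have "card (P ` T) \<le> 3" using assms card_image_le[OF fin, of P] by simp
    ultimately have "card (P ` T) = 3" "vec.dim (P ` T) = 3" using * by auto
    then have "vec.independent (P ` T)"
      using fin vec.card_le_dim_spanning[of "P ` T" "P ` T"] by (simp add: vec.span_superset)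
    moreover have "inj_on P T"
      using \<open>card (P ` T) = 3\<close> assms fin by (simp add: eq_card_imp_inj_on)
    ultimately show "inj_on P T \<and> vec.independent (P ` T)" by blast
  qed
  then show ?thesis
    using bracket_value_nonzero_iff[of T "column_matrix P"] assms
    by (auto simp: on_common_line_iff)
qed

section \<open>Evaluating the homogeneous coordinate ring at a matrix\<close>

lemma carrier_mult:
  assumes "p \<in> carrier (bracket_poly_ring R)" "q \<in> carrier (bracket_poly_ring R)"
  shows "p * q \<in> carrier (bracket_poly_ring R)"
proof -
  interpret cring "bracket_poly_ring R" by (rule cring_bracket_poly_ring)
  show ?thesis using m_closed[OF assms] by (simp add: bracket_poly_ring_def)
qed

lemma carrier_diff:
  assumes "p \<in> carrier (bracket_poly_ring R)" "q \<in> carrier (bracket_poly_ring R)"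
  shows "p - q \<in> carrier (bracket_poly_ring R)"
  using assms keys_diff[of p q] by (fastforce simp: bracket_poly_ring_def)

lemma ideal_eval_kernel:
  "ideal {p \<in> carrier (bracket_poly_ring R). eval_poly b p = 0} (bracket_poly_ring R)" (is "ideal ?J ?R")
proof -
  interpret cring ?R by (rule cring_bracket_poly_ring)
  have add: "x \<oplus>\<^bsub>?R\<^esub> y = x + y" and mult: "x \<otimes>\<^bsub>?R\<^esub> y = x * y" and zero: "\<zero>\<^bsub>?R\<^esub> = 0" for x y
    by (simp_all add: bracket_poly_ring_def)
  have neg: "\<ominus>\<^bsub>?R\<^esub> x = - x" if "x \<in> carrier ?R" for x
  proof -
    have "- x \<in> carrier ?R" using that by (simp add: bracket_poly_ring_def)
    then show ?thesis using minus_equality[of "- x" x] that by (simp add: add zero)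
  qed
  show ?thesis
  proof (rule idealI)
    show "subgroup ?J (add_monoid ?R)"
    proof (rule add.subgroupI)
      show "\<And>x. x \<in> ?J \<Longrightarrow> \<ominus>\<^bsub>?R\<^esub> x \<in> ?J"
        using neg a_inv_closed by fastforce
      show "\<And>x y. x \<in> ?J \<Longrightarrow> y \<in> ?J \<Longrightarrow> x \<oplus>\<^bsub>?R\<^esub> y \<in> ?J"
        using a_closed by (force simp: add)
      show "?J \<noteq> {}"
        using zero_closed by (auto simp: zero intro!: exI[of _ 0])
    qed blast
  next
    show "x \<otimes>\<^bsub>?R\<^esub> a \<in> ?J" "a \<otimes>\<^bsub>?R\<^esub> x \<in> ?J" if "a \<in> ?J" "x \<in> carrier ?R" for a x
      using that m_closed[of x a] m_closed[of a x] by (simp_all add: mult)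
  qed (rule ring_axioms)
qed

lemma eval_plucker_ideal:
  fixes A :: "complex^('n::{finite,linorder})^3"
  assumes "p \<in> plucker_ideal TYPE(3)"
  shows "eval_poly (bracket_value A) p = 0"
proof -
  interpret cring "bracket_poly_ring TYPE(3) :: 'n bracket_poly ring" by (rule cring_bracket_poly_ring)
  have "plucker_ideal TYPE(3) \<subseteq> {p \<in> carrier (bracket_poly_ring TYPE(3)). eval_poly (bracket_value A) p = 0}"
    unfolding plucker_ideal_def
    using plucker_relations_in_carrier[of "TYPE(3)"]
    by (intro genideal_minimal ideal_eval_kernel) (auto simp: eval_plucker_relation)
  with assms show ?thesis by blast
qed

definition poly_class :: "('n::linorder) bracket_poly \<Rightarrow> 'n bracket_poly set" where
  "poly_class p = plucker_ideal TYPE(3) +>\<^bsub>bracket_poly_ring TYPE(3)\<^esub> p"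

lemma eval_poly_class:
  fixes A :: "complex^('n::{finite,linorder})^3"
  assumes "q \<in> poly_class p"
  shows "eval_poly (bracket_value A) q = eval_poly (bracket_value A) p"
  using assms eval_plucker_ideal[of _ A]
  by (auto simp: poly_class_def a_r_coset_def' bracket_poly_ring_def)

lemma self_mem_poly_class:
  assumes "p \<in> carrier (bracket_poly_ring TYPE(3))"
  shows "p \<in> poly_class p"
proof -
  interpret cring "bracket_poly_ring TYPE(3) :: 'a bracket_poly ring" by (rule cring_bracket_poly_ring)
  interpret ideal "plucker_ideal TYPE(3)" "bracket_poly_ring TYPE(3) :: 'a bracket_poly ring"
    by (rule ideal_plucker_ideal)
  show ?thesis unfolding poly_class_def using assms by (rule a_rcos_self)
qed

lemma poly_class_closed:
  assumes "p \<in> carrier (bracket_poly_ring TYPE(3))"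
  shows "poly_class p \<in> carrier (coord_ring TYPE(3))"
proof -
  interpret ideal "plucker_ideal TYPE(3)" "bracket_poly_ring TYPE(3) :: 'a bracket_poly ring"
    by (rule ideal_plucker_ideal)
  show ?thesis unfolding poly_class_def coord_ring_def
    using assms ring_hom_closed[OF rcos_ring_hom] by blast
qed

lemma poly_class_homogeneous:
  assumes "p \<in> carrier (bracket_poly_ring TYPE(3))" "homogeneous_poly d p"
  shows "poly_class p \<in> homogeneous_elements TYPE(3) d"
  using assms self_mem_poly_class poly_class_closed by (auto simp: homogeneous_elements_def)

text \<open>
  The classes of the polynomials vanishing at the minors of \<open>A\<close> form an ideal of the coordinate ring,
  as the image of an ideal of the polynomial ring; it contains the ideal generated by \<open>S\<close>. That
  \<open>p\<close> itself vanishes there follows because the value does not depend on the representative.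
\<close>

lemma eval_genideal:
  fixes A :: "complex^('n::{finite,linorder})^3"
  assumes S: "\<And>F. F \<in> S \<Longrightarrow> \<exists>q \<in> carrier (bracket_poly_ring TYPE(3)).
      F = poly_class q \<and> eval_poly (bracket_value A) q = 0"
    and "p \<in> carrier (bracket_poly_ring TYPE(3))"
    and "poly_class p \<in> genideal (coord_ring TYPE(3)) S"
  shows "eval_poly (bracket_value A) p = 0"
proof -
  let ?R = "bracket_poly_ring TYPE(3) :: 'n bracket_poly ring"
  let ?J = "{p \<in> carrier ?R. eval_poly (bracket_value A) p = 0}"
  interpret R: cring ?R by (rule cring_bracket_poly_ring)
  interpret Q: cring "coord_ring TYPE(3) :: 'n bracket_poly set ring" by (rule cring_coord_ring)
  have "ideal (poly_class ` ?J) (coord_ring TYPE(3))"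
    using R.ring_ideal_imp_quot_ideal[OF ideal_plucker_ideal ideal_eval_kernel]
    unfolding poly_class_def coord_ring_def .
  moreover have "S \<subseteq> poly_class ` ?J" using S by blast
  ultimately have "genideal (coord_ring TYPE(3)) S \<subseteq> poly_class ` ?J"
    by (rule Q.genideal_minimal)
  with assms(3) obtain q where q: "q \<in> ?J" "poly_class p = poly_class q" by blast
  then have "eval_poly (bracket_value A) p = eval_poly (bracket_value A) q"
    using eval_poly_class[of p q A] self_mem_poly_class[OF assms(2)] by simp
  then show ?thesis using q by simp
qed

text \<open>
  The zero locus of a homogeneous element is Zariski closed, so it contains the closure of the stratum
  as soon as it contains the stratum.
\<close>

lemma poly_class_mem_matroid_variety_ideal:
  assumes "p \<in> carrier (bracket_poly_ring TYPE(3))" "homogeneous_poly d p"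
    and vanish: "\<And>y (A :: complex^('n::{finite,linorder})^3).
      y \<in> matroid_stratum TYPE(3) x \<Longrightarrow> represents A y \<Longrightarrow> eval_poly (bracket_value A) p = 0"
  shows "poly_class p \<in> matroid_variety_ideal TYPE(3) x"
proof -
  let ?Z = "{y \<in> Gr TYPE(3). \<forall>f \<in> {poly_class p}. vanishes_at TYPE(3) f y}"
  have "zariski_closed TYPE(3) ?Z"
    unfolding zariski_closed_def
    using poly_class_homogeneous[OF assms(1,2)] by (intro exI[of _ "{poly_class p}"]) blast
  moreover have "matroid_stratum TYPE(3) x \<subseteq> ?Z"
    using vanish eval_poly_class[of _ p] by (fastforce simp: matroid_stratum_def vanishes_at_def)
  ultimately have "matroid_variety TYPE(3) x \<subseteq> ?Z"
    unfolding matroid_variety_def by blast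
  then show ?thesis
    using poly_class_closed[OF assms(1)] by (auto simp: matroid_variety_ideal_def)
qed

text \<open>
  A point at which exactly one member of the family is nonzero shows that this member is not
  in the ideal generated by the others.
\<close>

lemma independent_family_poly_classI:
  fixes ps :: "('n::{finite,linorder}) bracket_poly list"
  assumes "set ps \<subseteq> carrier (bracket_poly_ring TYPE(3))"
    and sep: "\<And>i. i < length ps \<Longrightarrow> \<exists>A :: complex^('n::{finite,linorder})^3.
      \<forall>j < length ps. eval_poly (bracket_value A) (ps ! j) = 0 \<longleftrightarrow> j \<noteq> i"
  shows "independent_family (coord_ring TYPE(3)) (map poly_class ps)"
  unfolding independent_family_def
proof (intro allI impI notI)
  fix i assume i: "i < length (map poly_class ps)"
    and mem: "map poly_class ps ! i \<in> genideal (coord_ring TYPE(3))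
      {map poly_class ps ! j | j. j < length (map poly_class ps) \<and> j \<noteq> i}"
  obtain A :: "complex^('n::{finite,linorder})^3"
    where A: "\<forall>j < length ps. eval_poly (bracket_value A) (ps ! j) = 0 \<longleftrightarrow> j \<noteq> i"
    using sep i by auto
  have "eval_poly (bracket_value A) (ps ! i) = 0"
  proof (rule eval_genideal)
    fix F assume "F \<in> {map poly_class ps ! j | j. j < length (map poly_class ps) \<and> j \<noteq> i}"
    then obtain j where "j < length ps" "j \<noteq> i" "F = poly_class (ps ! j)" by auto
    with A assms(1) show "\<exists>q\<in>carrier (bracket_poly_ring TYPE(3)).
        F = poly_class q \<and> eval_poly (bracket_value A) q = 0"
      by (intro bexI[of _ "ps ! j"]) auto
  next
    show "ps ! i \<in> carrier (bracket_poly_ring TYPE(3))" using i assms(1) by auto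
    show "poly_class (ps ! i) \<in> genideal (coord_ring TYPE(3))
        {map poly_class ps ! j | j. j < length (map poly_class ps) \<and> j \<noteq> i}"
      using mem i by simp
  qed
  with A i show False by simp
qed

lemma poly_class_notin_nonbasis_ideal:
  fixes A :: "complex^('n::{finite,linorder})^3"
  assumes "p \<in> carrier (bracket_poly_ring TYPE(3))"
    and "\<And>l. card l = 3 \<Longrightarrow> l \<notin> matroid_bases TYPE(3) x \<Longrightarrow> bracket_value A l = 0"
    and "eval_poly (bracket_value A) p \<noteq> 0"
  shows "poly_class p \<notin> nonbasis_ideal TYPE(3) x"
proof
  assume "poly_class p \<in> nonbasis_ideal TYPE(3) x"
  then have "eval_poly (bracket_value A) p = 0"
    unfolding nonbasis_ideal_def
  proof (intro eval_genideal[of _ A])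
    fix F assume "F \<in> {bracket_class TYPE(3) l | l. card l = CARD(3) \<and> l \<notin> matroid_bases TYPE(3) x}"
    then obtain l where l: "F = poly_class (bracket_var l)" "card l = 3" "l \<notin> matroid_bases TYPE(3) x"
      by (auto simp: bracket_class_def poly_class_def)
    then have "bracket_var l \<in> carrier (bracket_poly_ring TYPE(3))"
      by (simp add: bracket_poly_ring_def bracket_var_def)
    with l assms(2) show "\<exists>q\<in>carrier (bracket_poly_ring TYPE(3)). F = poly_class q \<and> eval_poly (bracket_value A) q = 0"
      by auto
  qed (use assms(1) in auto)
  with assms(3) show False by simp
qed

section \<open>Points of intersection of two lines\<close>

text \<open>
  The point of intersection of the line through \<open>a\<close>, \<open>b\<close> with the line through \<open>c\<close>, \<open>d\<close>: a
  combination of \<open>a\<close> and \<open>b\<close> on which the linear form \<open>[_ c d]\<close> vanishes. It is the zero vector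
  exactly if one of the pairs is dependent or the two lines coincide.
\<close>

definition line_meet :: "complex^3 \<Rightarrow> complex^3 \<Rightarrow> complex^3 \<Rightarrow> complex^3 \<Rightarrow> complex^3" where
  "line_meet a b c d = triple_product a c d *s b - triple_product b c d *s a"

text \<open>
  In terms of cross products \<open>line_meet a b c d = n \<times> n'\<close> for the normal vectors \<open>n = a \<times> b\<close> and
  \<open>n' = c \<times> d\<close> of the two lines, and
  \<open>(n \<times> n') \<times> p = (n \<bullet> p) n' - (n' \<bullet> p) n\<close>, which is 0 when \<open>p\<close> is on both lines. Vectors with cross
  product 0 are parallel, whence \<open>line_meet a b c d\<close> is a multiple of the nonzero vector \<open>p\<close>, even if
  the two lines coincide.
\<close>

lemma line_meet_parallel:
  assumes "triple_product a b p = 0" "triple_product c d p = 0" "p \<noteq> 0"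
  shows "\<exists>k. line_meet a b c d = k *s p"
proof -
  let ?m = "line_meet a b c d"
  \<comment> \<open>The three coordinates of (n \<times> n') \<times> p.\<close>
  have
    "?m $ 1 * p $ 2 - ?m $ 2 * p $ 1 = triple_product a b p * (c $ 1 * d $ 2 - c $ 2 * d $ 1)
       - triple_product c d p * (a $ 1 * b $ 2 - a $ 2 * b $ 1)"
    "?m $ 3 * p $ 1 - ?m $ 1 * p $ 3 = triple_product a b p * (c $ 3 * d $ 1 - c $ 1 * d $ 3)
       - triple_product c d p * (a $ 3 * b $ 1 - a $ 1 * b $ 3)"
    "?m $ 2 * p $ 3 - ?m $ 3 * p $ 2 = triple_product a b p * (c $ 2 * d $ 3 - c $ 3 * d $ 2)
       - triple_product c d p * (a $ 2 * b $ 3 - a $ 3 * b $ 2)"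
    by (simp_all add: line_meet_def triple_product_def algebra_simps)
  then have minor: "?m $ 1 * p $ 2 = ?m $ 2 * p $ 1" "?m $ 1 * p $ 3 = ?m $ 3 * p $ 1"
      "?m $ 2 * p $ 3 = ?m $ 3 * p $ 2"
    by (simp_all add: assms)
  obtain i where i: "p $ i \<noteq> 0"
    using assms(3) by (auto simp: vec_eq_iff)
  have "?m $ j * p $ i = ?m $ i * p $ j" for j
    using minor exhaust_3[of i] exhaust_3[of j] by auto
  then have "?m = (?m $ i / p $ i) *s p"
    using i by (simp add: vec_eq_iff field_simps)
  then show ?thesis ..
qed

lemma triple_product_scale:
  "triple_product (k *s u) v w = k * triple_product u v w"
  "triple_product u (k *s v) w = k * triple_product u v w"
  "triple_product u v (k *s w) = k * triple_product u v w"
  by (simp_all add: triple_product_def algebra_simps)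

lemma triple_product_diff:
  "triple_product (u - u') v w = triple_product u v w - triple_product u' v w"
  "triple_product u (v - v') w = triple_product u v w - triple_product u v' w"
  "triple_product u v (w - w') = triple_product u v w - triple_product u v w'"
  by (simp_all add: triple_product_def algebra_simps)

lemma triple_product_meet:
  "triple_product u v (line_meet a b c d) =
     triple_product a c d * triple_product u v b - triple_product b c d * triple_product u v a"
  "triple_product u (line_meet a b c d) w =
     triple_product a c d * triple_product u b w - triple_product b c d * triple_product u a w"
  "triple_product (line_meet a b c d) v w =
     triple_product a c d * triple_product b v w - triple_product b c d * triple_product a v w"
  by (simp_all only: line_meet_def triple_product_diff triple_product_scale)

text \<open>
  The bracket polynomials with values \<open>[u v m]\<close>, \<open>[u m n]\<close> and \<open>[l m n]\<close>, where \<open>l\<close>, \<open>m\<close>, \<open>n\<close> are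
  intersection points; a quadruple \<open>(a, b, c, d)\<close> of columns stands for the intersection of ab and cd. Each
  is the expansion of one intersection point by linearity and so of degree one more
  than the preceding one.
\<close>

fun meet_quadric :: "9 \<Rightarrow> 9 \<Rightarrow> 9 \<times> 9 \<times> 9 \<times> 9 \<Rightarrow> 9 bracket_poly" where
  "meet_quadric u v (a, b, c, d) = bracket [a, c, d] * bracket [u, v, b] - bracket [b, c, d] * bracket [u, v, a]"

fun meet_cubic :: "9 \<Rightarrow> 9 \<times> 9 \<times> 9 \<times> 9 \<Rightarrow> 9 \<times> 9 \<times> 9 \<times> 9 \<Rightarrow> 9 bracket_poly" where
  "meet_cubic u (a, b, c, d) m = bracket [a, c, d] * meet_quadric u b m - bracket [b, c, d] * meet_quadric u a m"

fun meet_quartic :: "9 \<times> 9 \<times> 9 \<times> 9 \<Rightarrow> 9 \<times> 9 \<times> 9 \<times> 9 \<Rightarrow> 9 \<times> 9 \<times> 9 \<times> 9 \<Rightarrow> 9 bracket_poly" where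
  "meet_quartic (a, b, c, d) m n = bracket [a, c, d] * meet_cubic b m n - bracket [b, c, d] * meet_cubic a m n"

fun column_meet :: "complex^9^3 \<Rightarrow> 9 \<times> 9 \<times> 9 \<times> 9 \<Rightarrow> complex^3" where
  "column_meet A (a, b, c, d) = line_meet (column a A) (column b A) (column c A) (column d A)"

lemma eval_meet_quadric:
  "eval_poly (bracket_value A) (meet_quadric u v m) = triple_product (column u A) (column v A) (column_meet A m)"
  by (cases m) (simp add: eval_bracket_three triple_product_meet)

lemma eval_meet_cubic:
  "eval_poly (bracket_value A) (meet_cubic u m n) = triple_product (column u A) (column_meet A m) (column_meet A n)"
  by (cases m) (simp add: eval_bracket_three eval_meet_quadric triple_product_meet(2))

lemma eval_meet_quartic:
  "eval_poly (bracket_value A) (meet_quartic l m n) =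
     triple_product (column_meet A l) (column_meet A m) (column_meet A n)"
  by (cases l) (simp add: eval_bracket_three eval_meet_cubic triple_product_meet(3))

lemma meet_quadric_homogeneous: "homogeneous_poly 2 (meet_quadric u v m)"
proof -
  have "homogeneous_poly 2 (bracket xs * bracket ys)" for xs ys :: "9 list"
    using homogeneous_poly_mult[OF homogeneous_bracket[of xs] homogeneous_bracket[of ys]]
    by (simp add: numeral_eq_Suc)
  then show ?thesis by (cases m) (simp add: homogeneous_poly_diff)
qed

lemma meet_cubic_homogeneous: "homogeneous_poly 3 (meet_cubic u m n)"
proof -
  have "homogeneous_poly 3 (bracket xs * meet_quadric u v n)" for xs u v
    using homogeneous_poly_mult[OF homogeneous_bracket[of xs] meet_quadric_homogeneous[of u v n]]
    by (simp add: numeral_eq_Suc)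
  then show ?thesis by (cases m) (simp add: homogeneous_poly_diff)
qed

lemma meet_quartic_homogeneous: "homogeneous_poly 4 (meet_quartic l m n)"
proof -
  have "homogeneous_poly 4 (bracket xs * meet_cubic u m n)" for xs u
    using homogeneous_poly_mult[OF homogeneous_bracket[of xs] meet_cubic_homogeneous[of u m n]] by simp
  then show ?thesis by (cases l) (simp add: homogeneous_poly_diff)
qed

lemma bracket_three_carrier: "bracket [a, b, c] \<in> carrier (bracket_poly_ring TYPE(3))"
  by (rule bracket_in_carrier) simp

lemma meet_quadric_carrier: "meet_quadric u v m \<in> carrier (bracket_poly_ring TYPE(3))"
  by (cases m) (simp only: meet_quadric.simps carrier_diff carrier_mult bracket_three_carrier)

lemma meet_cubic_carrier: "meet_cubic u m n \<in> carrier (bracket_poly_ring TYPE(3))"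
  by (cases m) (simp only: meet_cubic.simps carrier_diff carrier_mult bracket_three_carrier meet_quadric_carrier)

lemma meet_quartic_carrier: "meet_quartic l m n \<in> carrier (bracket_poly_ring TYPE(3))"
  by (cases l) (simp only: meet_quartic.simps carrier_diff carrier_mult bracket_three_carrier meet_cubic_carrier)

declare meet_quadric.simps [simp del] meet_cubic.simps [simp del] meet_quartic.simps [simp del]

section \<open>The Pascal matroid\<close>

definition pascal_lines :: "9 set set" where
  "pascal_lines = {{1, 2, 7}, {4, 5, 7}, {2, 3, 8}, {5, 6, 8}, {3, 4, 9}, {1, 6, 9}, {7, 8, 9}}"

definition pascal_polys :: "9 bracket_poly list" where
  "pascal_polys =
    (let l7 = (1, 2, 4, 5); l8 = (2, 3, 5, 6); l9 = (3, 4, 6, 1) in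
     [meet_quartic l7 l8 l9,
      meet_cubic 7 l8 l9, meet_cubic 8 l9 l7, meet_cubic 9 l7 l8,
      meet_quadric 7 8 l9, meet_quadric 8 9 l7, meet_quadric 9 7 l8])"

text \<open>
  Since \<open>P 1\<close>, \<open>P 2\<close>, \<open>P 3\<close> are not collinear, the matrix of the configuration has rank 3 and its
  minors determine the matroid.
\<close>

lemma pascal_matroid:
  assumes "pascal_configuration P"
  shows "represents (column_matrix P) (row_span (column_matrix P))"
    and "card T = 3 \<Longrightarrow> T \<in> matroid_bases TYPE(3) (row_span (column_matrix P)) \<longleftrightarrow> T \<notin> pascal_lines"
proof -
  have lines: "{T. card T = 3 \<and> on_common_line (P ` T)} = pascal_lines"
    using assms unfolding pascal_configuration_def pascal_lines_def by (elim conjE)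
  have line: "bracket_value (column_matrix P) T = 0 \<longleftrightarrow> T \<in> pascal_lines" if "card T = 3" for T
    unfolding lines[symmetric] using that by (simp add: bracket_value_column_matrix_eq_0_iff)
  have "{1, 2, 3} \<notin> pascal_lines"
    by (simp add: pascal_lines_def set_eq_subset)
  then have "bracket_value (column_matrix P) {1, 2, 3} \<noteq> 0"
    using line[of "{1, 2, 3}"] by simp
  then show rep: "represents (column_matrix P) (row_span (column_matrix P))"
    by (rule represents_row_span)
  show "T \<in> matroid_bases TYPE(3) (row_span (column_matrix P)) \<longleftrightarrow> T \<notin> pascal_lines"
    if "card T = 3"
    using that line[OF that] by (simp add: mem_matroid_bases_iff[OF rep])
qed

text \<open>
  The matroid alone forces the three intersection points of opposite sides to be
  multiples of the columns 7, 8, 9, which are collinear.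
\<close>

lemma eval_pascal_polys_eq_0:
  fixes A :: "complex^9^3"
  assumes "\<And>T. card T = 3 \<Longrightarrow> bracket_value A T = 0 \<longleftrightarrow> T \<in> pascal_lines"
    and "p \<in> set pascal_polys"
  shows "eval_poly (bracket_value A) p = 0"
proof -
  let ?c = "\<lambda>j. column j A"
  have line: "triple_product (?c i) (?c j) (?c k) = 0 \<longleftrightarrow> {i, j, k} \<in> pascal_lines" if "distinct [i, j, k]" for i j k
    using assms(1)[of "{i, j, k}"] bracket_value_eq_0_iff[OF that, of A] that by simp
  have nz: "?c k \<noteq> 0" if "distinct [i, j, k]" "{i, j, k} \<notin> pascal_lines" for i j k
    using line[OF that(1)] that(2) by (auto simp: triple_product_def)
  \<comment> \<open>Each of the columns 7, 8, 9 is part of a basis of the matroid.\<close>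
  have "?c 7 \<noteq> 0" "?c 8 \<noteq> 0" "?c 9 \<noteq> 0"
    using nz[of 1 3 7] nz[of 1 2 8] nz[of 1 2 9] by (simp_all add: pascal_lines_def set_eq_subset)
  moreover have
    "triple_product (?c 1) (?c 2) (?c 7) = 0" "triple_product (?c 4) (?c 5) (?c 7) = 0"
    "triple_product (?c 2) (?c 3) (?c 8) = 0" "triple_product (?c 5) (?c 6) (?c 8) = 0"
    "triple_product (?c 3) (?c 4) (?c 9) = 0" "triple_product (?c 6) (?c 1) (?c 9) = 0"
    by (simp_all add: line) (simp_all add: pascal_lines_def insert_commute)
  ultimately obtain k7 k8 k9 where
    "column_meet A (1, 2, 4, 5) = k7 *s ?c 7" "column_meet A (2, 3, 5, 6) = k8 *s ?c 8"
    "column_meet A (3, 4, 6, 1) = k9 *s ?c 9"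
    using line_meet_parallel by (metis column_meet.simps)
  moreover have "triple_product (?c 7) (?c 8) (?c 9) = 0" "triple_product (?c 8) (?c 9) (?c 7) = 0"
      "triple_product (?c 9) (?c 7) (?c 8) = 0"
    by (simp_all add: line) (simp_all add: pascal_lines_def insert_commute)
  ultimately show ?thesis
    using assms(2)
    by (auto simp: pascal_polys_def Let_def eval_meet_quartic eval_meet_cubic eval_meet_quadric triple_product_scale)
qed

definition nine_columns :: "complex^3 \<Rightarrow> complex^3 \<Rightarrow> complex^3 \<Rightarrow> complex^3 \<Rightarrow> complex^3 \<Rightarrow>
    complex^3 \<Rightarrow> complex^3 \<Rightarrow> complex^3 \<Rightarrow> complex^3 \<Rightarrow> complex^9^3" where
  "nine_columns v1 v2 v3 v4 v5 v6 v7 v8 v9 =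
    column_matrix (\<lambda>j. if j = 1 then v1 else if j = 2 then v2 else if j = 3 then v3
      else if j = 4 then v4 else if j = 5 then v5 else if j = 6 then v6
      else if j = 7 then v7 else if j = 8 then v8 else v9)"

lemma column_nine_columns:
  "column 1 (nine_columns v1 v2 v3 v4 v5 v6 v7 v8 v9) = v1"
  "column 2 (nine_columns v1 v2 v3 v4 v5 v6 v7 v8 v9) = v2"
  "column 3 (nine_columns v1 v2 v3 v4 v5 v6 v7 v8 v9) = v3"
  "column 4 (nine_columns v1 v2 v3 v4 v5 v6 v7 v8 v9) = v4"
  "column 5 (nine_columns v1 v2 v3 v4 v5 v6 v7 v8 v9) = v5"
  "column 6 (nine_columns v1 v2 v3 v4 v5 v6 v7 v8 v9) = v6"
  "column 7 (nine_columns v1 v2 v3 v4 v5 v6 v7 v8 v9) = v7"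
  "column 8 (nine_columns v1 v2 v3 v4 v5 v6 v7 v8 v9) = v8"
  "column 9 (nine_columns v1 v2 v3 v4 v5 v6 v7 v8 v9) = v9"
  unfolding nine_columns_def column_column_matrix by simp_all

text \<open>
  The list of truth values records which polynomial survives: the entry at \<open>i\<close> and no other.
\<close>

definition separates :: "complex^9^3 \<Rightarrow> nat \<Rightarrow> bool" where
  "separates A i \<longleftrightarrow> (\<forall>l \<in> pascal_lines. bracket_value A l = 0) \<and>
     map (\<lambda>p. eval_poly (bracket_value A) p \<noteq> 0) pascal_polys = (replicate 7 False)[i := True]"

lemma separatesI:
  fixes A :: "complex^9^3"
  defines "c \<equiv> \<lambda>j. column j A"
  defines "m7 \<equiv> line_meet (c 1) (c 2) (c 4) (c 5)" and "m8 \<equiv> line_meet (c 2) (c 3) (c 5) (c 6)"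
    and "m9 \<equiv> line_meet (c 3) (c 4) (c 6) (c 1)"
  assumes lines: "triple_product (c 1) (c 2) (c 7) = 0" "triple_product (c 4) (c 5) (c 7) = 0"
    "triple_product (c 2) (c 3) (c 8) = 0" "triple_product (c 5) (c 6) (c 8) = 0"
    "triple_product (c 3) (c 4) (c 9) = 0" "triple_product (c 1) (c 6) (c 9) = 0"
    "triple_product (c 7) (c 8) (c 9) = 0"
    and vals: "[triple_product m7 m8 m9 \<noteq> 0,
      triple_product (c 7) m8 m9 \<noteq> 0, triple_product (c 8) m9 m7 \<noteq> 0, triple_product (c 9) m7 m8 \<noteq> 0,
      triple_product (c 7) (c 8) m9 \<noteq> 0, triple_product (c 8) (c 9) m7 \<noteq> 0, triple_product (c 9) (c 7) m8 \<noteq> 0] =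
      (replicate 7 False)[i := True]"
  shows "separates A i"
  unfolding separates_def
proof
  show "\<forall>l\<in>pascal_lines. bracket_value A l = 0"
    using lines by (simp add: pascal_lines_def bracket_value_eq_0_iff c_def)
  show "map (\<lambda>p. eval_poly (bracket_value A) p \<noteq> 0) pascal_polys = (replicate 7 False)[i := True]"
    unfolding vals[symmetric] pascal_polys_def Let_def list.map eval_meet_quartic eval_meet_cubic
      eval_meet_quadric column_meet.simps m7_def m8_def m9_def c_def ..
qed

lemma line_meet_zero [simp]:
  "line_meet 0 b c d = 0" "line_meet a 0 c d = 0" "line_meet a b 0 d = 0" "line_meet a b c 0 = 0"
  by (simp_all add: line_meet_def triple_product_def)

lemma triple_product_zero [simp]:
  "triple_product 0 v w = 0" "triple_product u 0 w = 0" "triple_product u v 0 = 0"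
  by (simp_all add: triple_product_def)

text \<open>
  A zero column among 7, 8, 9 annihilates the brackets of all lines through that point and all of the
  seven polynomials in which the column occurs. For the quartic it is thus enough to set the columns
  7, 8, 9 to zero and to choose \<open>P1, \<dots>, P6\<close> off every conic. For the cubic containing column 7,
  the columns 8 and 9 are zero, and \<open>P1, P2, P4, P5, P7\<close> are placed on one line; this makes m7
  zero and the brackets 127 and 457 vanish. For the quadric containing the columns 7 and 8, column 9
  is zero, and the columns 2 and 5 are zero; this makes m7 and m8 zero and the four brackets of the
  lines through \<open>P7\<close> or \<open>P8\<close> other than 789 vanish. The remaining matrices arise from these by
  rotating the hexagon.
\<close>

lemma separating_matrices:
  defines "e1 \<equiv> vector [1, 0, 0] :: complex^3" and "e2 \<equiv> vector [0, 1, 0]" and "e3 \<equiv> vector [0, 0, 1]"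
  shows
    "separates (nine_columns e1 e2 e3 (e2 + e3) (e1 + e3) (e1 + e2) 0 0 0) 0"
    "separates (nine_columns e1 e1 e3 e1 e2 (e2 + e3) e2 0 0) 1"
    "separates (nine_columns (e2 + e3) e1 e1 e3 e1 e2 0 e2 0) 2"
    "separates (nine_columns e2 (e2 + e3) e1 e1 e3 e1 0 0 e2) 3"
    "separates (nine_columns e3 0 e1 e3 0 e2 e1 e2 0) 4"
    "separates (nine_columns e2 e3 0 e1 e3 0 0 e1 e2) 5"
    "separates (nine_columns 0 e2 e3 0 e1 e3 e2 0 e1) 6"
  unfolding e1_def e2_def e3_def
  by (rule separatesI;
    simp add: column_nine_columns line_meet_def triple_product_def eval_nat_numeral)+

theorem theorem3p0p2:
  fixes P :: "9 \<Rightarrow> complex^3" and x :: "(complex^9) set"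
  assumes "pascal_configuration P"
    and "x = row_span (column_matrix P)"
  shows "\<exists>f gs hs.
      f \<in> homogeneous_elements TYPE(3) 4 \<and>
      length gs = 3 \<and> set gs \<subseteq> homogeneous_elements TYPE(3) 3 \<and>
      length hs = 3 \<and> set hs \<subseteq> homogeneous_elements TYPE(3) 2 \<and>
      set (f # gs @ hs) \<subseteq> matroid_variety_ideal TYPE(3) x - nonbasis_ideal TYPE(3) x \<and>
      independent_family (coord_ring TYPE(3)) (f # gs @ hs)"
proof -
  let ?ps = pascal_polys
  let ?gs = "take 3 (drop 1 ?ps)" and ?hs = "drop 4 ?ps"
  have ps: "?ps = hd ?ps # ?gs @ ?hs" "length ?ps = 7"
    by (simp_all add: pascal_polys_def Let_def)
  have homogeneous: "homogeneous_poly 4 (hd ?ps)" "\<forall>p \<in> set ?gs. homogeneous_poly 3 p"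
      "\<forall>p \<in> set ?hs. homogeneous_poly 2 p"
    by (simp_all add: pascal_polys_def Let_def meet_quartic_homogeneous meet_cubic_homogeneous
        meet_quadric_homogeneous)
  have carrier: "set ?ps \<subseteq> carrier (bracket_poly_ring TYPE(3))"
    by (simp add: pascal_polys_def Let_def meet_quartic_carrier meet_cubic_carrier meet_quadric_carrier)
  have bases: "T \<in> matroid_bases TYPE(3) x \<longleftrightarrow> T \<notin> pascal_lines" if "card T = 3" for T
    using pascal_matroid(2)[OF assms(1) that] assms(2) by simp
  have vanish: "eval_poly (bracket_value A) p = 0"
    if "p \<in> set ?ps" "y \<in> matroid_stratum TYPE(3) x" "represents A y" for A :: "complex^9^3" and p y
  proof (rule eval_pascal_polys_eq_0[OF _ that(1)])
    fix T :: "9 set" assume "card T = 3"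
    then show "bracket_value A T = 0 \<longleftrightarrow> T \<in> pascal_lines"
      using that(2) mem_matroid_bases_iff[OF that(3), of T] bases[of T]
      by (auto simp: matroid_stratum_def)
  qed
  have separate: "\<exists>A. separates A i" if "i < 7" for i
  proof -
    from that consider "i = 0" | "i = 1" | "i = 2" | "i = 3" | "i = 4" | "i = 5" | "i = 6"
      by linarith
    then show ?thesis by cases (use separating_matrices in blast)+
  qed
  have eval_separates: "eval_poly (bracket_value A) (?ps ! j) = 0 \<longleftrightarrow> j \<noteq> i"
    if "separates A i" "i < 7" "j < 7" for A i j
  proof -
    have "(eval_poly (bracket_value A) (?ps ! j) \<noteq> 0) = (replicate 7 False)[i := True] ! j"
      using arg_cong[of _ _ "\<lambda>xs. xs ! j", OF conjunct2[OF that(1)[unfolded separates_def]]] that(3) ps(2)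
      by simp
    also have "\<dots> \<longleftrightarrow> j = i"
      using that(2,3) List.nth_replicate[of j 7 False] by (cases "i = j") auto
    finally show ?thesis by blast
  qed
  have member: "poly_class p \<in> matroid_variety_ideal TYPE(3) x - nonbasis_ideal TYPE(3) x"
    if p: "p \<in> set ?ps" for p
  proof
    have "p \<in> set (hd ?ps # ?gs @ ?hs)" using p ps(1) by simp
    then obtain d where "homogeneous_poly d p"
      using homogeneous by auto
    then show "poly_class p \<in> matroid_variety_ideal TYPE(3) x"
      using carrier p vanish by (intro poly_class_mem_matroid_variety_ideal) auto
    obtain i where i: "i < 7" "p = ?ps ! i"
      using p ps(2) by (auto simp: in_set_conv_nth)
    obtain A where A: "separates A i" using separate i by blast
    then have "eval_poly (bracket_value A) p \<noteq> 0" using eval_separates i by simp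
    moreover have "bracket_value A l = 0" if "card l = 3" "l \<notin> matroid_bases TYPE(3) x" for l
      using A bases that by (simp add: separates_def)
    ultimately show "poly_class p \<notin> nonbasis_ideal TYPE(3) x"
      using carrier p by (intro poly_class_notin_nonbasis_ideal) auto
  qed
  have indep: "independent_family (coord_ring TYPE(3)) (map poly_class ?ps)"
    using carrier
  proof (rule independent_family_poly_classI)
    fix i assume "i < length ?ps"
    then show "\<exists>A :: complex^9^3. \<forall>j < length ?ps. eval_poly (bracket_value A) (?ps ! j) = 0 \<longleftrightarrow> j \<noteq> i"
      using separate eval_separates ps(2) by metis
  qed
  let ?f = "poly_class (hd ?ps)" and ?Gs = "map poly_class ?gs" and ?Hs = "map poly_class ?hs"
  have split: "map poly_class ?ps = ?f # ?Gs @ ?Hs"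
    using arg_cong[OF ps(1), of "map poly_class"] by simp
  have sub: "set ?gs \<subseteq> set ?ps" "set ?hs \<subseteq> set ?ps" "hd ?ps \<in> set ?ps"
    by (simp_all add: pascal_polys_def Let_def)
  have "?f \<in> homogeneous_elements TYPE(3) 4" "set ?Gs \<subseteq> homogeneous_elements TYPE(3) 3"
      "set ?Hs \<subseteq> homogeneous_elements TYPE(3) 2"
    using sub carrier homogeneous by (auto intro!: poly_class_homogeneous)
  moreover have "length ?Gs = 3" "length ?Hs = 3"
    using ps(2) by simp_all
  moreover have "set (?f # ?Gs @ ?Hs) \<subseteq> matroid_variety_ideal TYPE(3) x - nonbasis_ideal TYPE(3) x"
    unfolding split[symmetric] using member by auto
  moreover have "independent_family (coord_ring TYPE(3)) (?f # ?Gs @ ?Hs)"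
    using indep unfolding split .
  ultimately show ?thesis by blast
qed

end
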